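(* Let $P(x)=ax^n+c$, where $a\in\mathbb{Q}$, $c\in\mathbb{R}$, and $n$ is a positive integer. If $n>1$, then it is not the case that $P(x)$ is complete modulo all large enough primes (that is, there are infinitely many primes $p$ such that $P(x)$ is not complete modulo $p$); hence the sequence $(\lfloor P(k)\rfloor)_{k\geq 1}$ is not u.d. in $\mathbb{Z}$.
   Context: A polynomial $P(x)\in\mathbb{R}[x]$ is complete modulo an integer $m\geq 2$ if for every integer $r$ the congruence $\lfloor P(x)\rfloor\equiv r \pmod m$ has a solution $x\in\mathbb{Z}$. An integer sequence $(a_k)_{k\geq 1}$ is u.d. (uniformly distributed) mod an integer $m\geq 2$ if for every integer $i$, $\lim_{N\to\infty}\frac{1}{N}\#\{k\in\{1,\ldots,N\}: a_k\equiv i \pmod m\}=\frac{1}{m}$. It is u.d. in $\mathbb{Z}$ if it is u.d. mod $m$ for all integers $m\geq 2$. Here $\lfloor r\rfloor$ denotes the greatest integer not exceeding $r$. *)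

theory Defs
  imports
    Complex_Main
    "HOL-Computational_Algebra.Polynomial"
    "HOL-Computational_Algebra.Primes"
    "HOL-Number_Theory.Cong"
begin

(* The notions below are meant for moduli m >= 2; every use supplies that bound. *)

definition complete_mod :: "real poly \<Rightarrow> int \<Rightarrow> bool" where
  "complete_mod P m \<longleftrightarrow> (\<forall>r::int. \<exists>x::int. [\<lfloor>poly P (of_int x)\<rfloor> = r] (mod m))"

(* Sequences are indexed from 1; the value at index 0 is irrelevant. *)

definition ud_mod :: "(nat \<Rightarrow> int) \<Rightarrow> int \<Rightarrow> bool" where
  "ud_mod s m \<longleftrightarrow>
     (\<forall>i::int. (\<lambda>N. real (card {k \<in> {1..N}. [s k = i] (mod m)}) / real N)
        \<longlonglongrightarrow> 1 / of_int m)"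

definition ud_in_Z :: "(nat \<Rightarrow> int) \<Rightarrow> bool" where
  "ud_in_Z s \<longleftrightarrow> (\<forall>m::int. m \<ge> 2 \<longrightarrow> ud_mod s m)"

end

theory Submission
  imports "HOL-Number_Theory.Residue_Primitive_Roots" Defs
begin

text \<open>
  Write \<open>a = A / B\<close> with \<open>B > 0\<close>, put \<open>C = \<lfloor>B c\<rfloor>\<close>, and let \<open>q\<close> be a prime divisor of \<open>n\<close>.
  If \<open>\<lfloor>P(x)\<rfloor> = v\<close> then \<open>A x\<^sup>n = B v - C + s\<close> for some \<open>0 \<le> s < B\<close>. Take a prime
  \<open>p \<equiv> 1 (mod q)\<close> not dividing \<open>A B\<close>, and let \<open>\<chi>\<close> be a surjective homomorphism from the units
  modulo \<open>p\<close> to the integers modulo \<open>q\<close>. It kills \<open>n\<close>-th powers, so one of the \<open>B\<close> consecutive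
  numbers \<open>B v - C + s\<close> is divisible by \<open>p\<close> or lies in the \<open>\<chi>\<close>-class of \<open>A\<close>. As \<open>B v - C\<close> runs
  through all residues when \<open>v\<close> does, \<open>P\<close> is incomplete modulo \<open>p\<close> as soon as some \<open>B\<close> consecutive
  units all avoid the class of \<open>A\<close>.

  Such a gap exists in every class \<open>e\<close>, for all sufficiently large \<open>p\<close> (\<open>long_gap_in_class\<close>).
  Suppose instead that every interval of length \<open>B\<close> meets \<open>p \<int>\<close> or class \<open>e\<close>. Multiplying by
  \<open>h\<close>, every progression of length \<open>B\<close> and difference \<open>h\<close> meets \<open>p \<int>\<close> or class \<open>e + \<chi>(h)\<close>.
  Colour the integers by \<open>\<chi>\<close>. Van der Waerden's theorem gives a long monochromatic progression of
  small numbers, with difference \<open>d\<close>, say; its colour has to be \<open>e + \<chi>(d)\<close>, and also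
  \<open>e + \<chi>(j d)\<close> for all small \<open>j\<close>, because it contains progressions with difference \<open>j d\<close>. Hence
  \<open>\<chi>(j) = 0\<close> for every small \<open>j\<close>. If \<open>e \<noteq> 0\<close>, the interval from \<open>1\<close> to \<open>B\<close> is then a gap. If
  \<open>e = 0\<close>, let \<open>N\<close> be the least positive number with \<open>\<chi>(N) \<noteq> 0\<close>, which is large. The Chinese
  remainder theorem gives a small \<open>a\<close> for which each \<open>a + i N\<close> with \<open>i < B\<close> has a small prime
  factor exceeding \<open>B\<close>. The cofactor is less than \<open>N\<close>, so all these numbers have class \<open>0\<close>, while
  one of them should have class \<open>\<chi>(N)\<close>.

  Infinitely many primes are congruent to \<open>1\<close> modulo \<open>q\<close>, so \<open>P\<close> is incomplete modulo arbitrarily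
  large primes. A residue class that is never attained has density \<open>0\<close> rather than \<open>1/m\<close>, which
  settles the failure of uniform distribution.
\<close>

section \<open>Monochromatic arithmetic progressions\<close>

text \<open>
  The colour-focusing step in the proof of van der Waerden's theorem. Without a monochromatic
  progression of \<open>k + 1\<close> terms there are \<open>s\<close> progressions of \<open>k\<close> terms, in distinct colours, that
  would all be prolonged downwards by the same point \<open>z\<close>. The induction on \<open>s\<close> colours each
  \<open>x\<close> by the whole pattern of \<open>f\<close> on a window starting at \<open>x\<close>: a progression of \<open>k\<close> equal windows
  repeats a fan of size \<open>s\<close>, and combining its differences with that of the windows makes room
  for one more colour. Progressions are indexed by \<open>{1..k}\<close> so that the point before the first term
  has index \<open>0\<close>.
\<close>

lemma focused_progressions:
  fixes r k :: nat
  assumes IH: "\<And>r. \<exists>W. \<forall>f::nat\<Rightarrow>nat. (\<forall>x. f x < r) \<longrightarrow>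
      (\<exists>a d. 0 < d \<and> a \<le> W \<and> d \<le> W \<and> (\<forall>i\<in>{1..k}. f (a + i * d) = f (a + d)))"
  shows "\<exists>M. \<forall>f::nat\<Rightarrow>nat. (\<forall>x. f x < r) \<longrightarrow>
      (\<exists>z d. 0 < d \<and> z \<le> M \<and> d \<le> M \<and> (\<forall>i\<le>k. f (z + i * d) = f z)) \<or>
      (\<exists>z C. z \<le> M \<and> C \<subseteq> {..<r} \<and> card C = s \<and>
        (\<forall>c\<in>C. \<exists>d. 0 < d \<and> d \<le> M \<and> (\<forall>i\<in>{1..k}. f (z + i * d) = c)))"
proof (induction s)
  case 0
  show ?case
    by (rule exI[of _ 0], intro allI impI, rule disjI2, rule exI[of _ 0], rule exI[of _ "{}"]) simp
next
  case (Suc s)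
  then obtain M where M: "\<forall>f::nat\<Rightarrow>nat. (\<forall>x. f x < r) \<longrightarrow>
      (\<exists>z d. 0 < d \<and> z \<le> M \<and> d \<le> M \<and> (\<forall>i\<le>k. f (z + i * d) = f z)) \<or>
      (\<exists>z C. z \<le> M \<and> C \<subseteq> {..<r} \<and> card C = s \<and>
        (\<forall>c\<in>C. \<exists>d. 0 < d \<and> d \<le> M \<and> (\<forall>i\<in>{1..k}. f (z + i * d) = c)))"
    by (rule exE)
  \<comment> \<open>A window of this length contains any fan \<open>z + i * d\<close> with \<open>z, d \<le> M\<close> and \<open>i \<le> k\<close>.\<close>
  define K where "K = M + k * M + 1"
  have "finite {xs. set xs \<subseteq> {..<r} \<and> length xs = K}"
    by (rule finite_lists_length_eq) simp
  then obtain code and R :: nat where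
      code: "code ` {xs. set xs \<subseteq> {..<r} \<and> length xs = K} = {i. i < R}"
        "inj_on code {xs. set xs \<subseteq> {..<r} \<and> length xs = K}"
    by (elim finite_imp_inj_to_nat_seg[THEN exE] exE conjE)
  obtain W where W: "\<forall>f::nat\<Rightarrow>nat. (\<forall>x. f x < R) \<longrightarrow>
      (\<exists>a d. 0 < d \<and> a \<le> W \<and> d \<le> W \<and> (\<forall>i\<in>{1..k}. f (a + i * d) = f (a + d)))"
    using IH[of R] by (rule exE)
  show ?case
  proof (rule exI[of _ "M + 2 * W"], intro allI impI)
    fix f :: "nat \<Rightarrow> nat" assume f: "\<forall>x. f x < r"
    define window where "window x = map f [x..<x + K]" for x
    have window_in: "window x \<in> {xs. set xs \<subseteq> {..<r} \<and> length xs = K}" for x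
      using f by (auto simp: window_def)
    have "\<forall>x. code (window x) < R"
      using code(1) window_in by blast
    then obtain a d where ad: "0 < d" "a \<le> W" "d \<le> W"
        and mono: "\<And>i. i \<in> {1..k} \<Longrightarrow> code (window (a + i * d)) = code (window (a + d))"
      using W[THEN spec, THEN mp, of "\<lambda>x. code (window x)"] by blast
    have windows_agree: "f (a + i * d + j) = f (a + d + j)" if "i \<in> {1..k}" "j < K" for i j
    proof -
      have "window (a + i * d) = window (a + d)"
        using inj_onD[OF code(2) mono[OF that(1)] window_in window_in] .
      then have "window (a + i * d) ! j = window (a + d) ! j" by simp
      then show ?thesis using that(2) by (simp add: window_def)
    qed
    let ?mono = "\<exists>z d. 0 < d \<and> z \<le> M + 2 * W \<and> d \<le> M + 2 * W \<and> (\<forall>i\<le>k. f (z + i * d) = f z)"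
    have lift_mono: ?mono if "0 < e" "z \<le> M" "e \<le> M"
        "\<forall>i\<le>k. f (a + d + (z + i * e)) = f (a + d + z)" for z e
      by (rule exI[of _ "a + d + z"], rule exI[of _ e]) (use that ad in \<open>auto simp: add.assoc\<close>)
    show "?mono \<or>
      (\<exists>z C. z \<le> M + 2 * W \<and> C \<subseteq> {..<r} \<and> card C = Suc s \<and>
        (\<forall>c\<in>C. \<exists>d. 0 < d \<and> d \<le> M + 2 * W \<and> (\<forall>i\<in>{1..k}. f (z + i * d) = c)))"
    proof (cases ?mono)
      case True
      then show ?thesis by (rule disjI1)
    next
      case no_mono: False
      then obtain z C where z: "z \<le> M" and C: "C \<subseteq> {..<r}" "card C = s"
        and fan: "\<And>c. c \<in> C \<Longrightarrow>
          \<exists>e. 0 < e \<and> e \<le> M \<and> (\<forall>i\<in>{1..k}. f (a + d + (z + i * e)) = c)"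
        using M[THEN spec, THEN mp, of "\<lambda>x. f (a + d + x)"] f lift_mono by blast
      define c0 where "c0 = f (a + d + z)"
      have "c0 \<notin> C"
      proof
        assume "c0 \<in> C"
        then obtain e where e: "0 < e" "e \<le> M" "\<forall>i\<in>{1..k}. f (a + d + (z + i * e)) = c0"
          using fan by blast
        have "f (a + d + (z + i * e)) = f (a + d + z)" if "i \<le> k" for i
          using e(3) that by (cases "i = 0") (auto simp: c0_def)
        then show False using no_mono lift_mono[OF e(1) z e(2)] by blast
      qed
      have "finite C" using C(1) finite_subset by blast
      have zK: "z < K" using z by (simp add: K_def)
      \<comment> \<open>The focus moves one step \<open>d\<close> down, to \<open>a + z\<close>; each old difference \<open>e\<close> becomes
        \<open>e + d\<close>, and \<open>d\<close> itself gives a progression of the new colour.\<close>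
      have new: "\<exists>e. 0 < e \<and> e \<le> M + 2 * W \<and> (\<forall>i\<in>{1..k}. f (a + z + i * e) = c)"
        if c: "c \<in> insert c0 C" for c
      proof (cases "c = c0")
        case True
        have "f (a + z + i * d) = c0" if "i \<in> {1..k}" for i
          using windows_agree[OF that zK] by (simp add: c0_def algebra_simps)
        then show ?thesis using True ad by (intro exI[of _ d]) auto
      next
        case False
        then obtain e where e: "0 < e" "e \<le> M"
            and ec: "\<forall>i\<in>{1..k}. f (a + d + (z + i * e)) = c"
          using fan c by blast
        have "f (a + z + i * (e + d)) = c" if i: "i \<in> {1..k}" for i
        proof -
          have "i * e \<le> k * M" using i e by (intro mult_le_mono) auto
          then have "z + i * e < K" using z by (simp add: K_def)
          from windows_agree[OF i this] have "f (a + i * d + (z + i * e)) = c"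
            using bspec[OF ec i] by (rule trans)
          moreover have "a + z + i * (e + d) = a + i * d + (z + i * e)"
            by (simp add: algebra_simps)
          ultimately show ?thesis by (simp only:)
        qed
        then show ?thesis using e ad by (intro exI[of _ "e + d"]) auto
      qed
      have "c0 < r" using f by (simp add: c0_def)
      show ?thesis
        by (rule disjI2, rule exI[of _ "a + z"], rule exI[of _ "insert c0 C"])
          (use new C \<open>c0 < r\<close> \<open>c0 \<notin> C\<close> \<open>finite C\<close> z ad in auto)
    qed
  qed
qed

text \<open>
  With as many focused progressions as there are colours, the focus itself has the colour of one of
  them and prolongs it.
\<close>

theorem van_der_Waerden:
  "\<exists>W. \<forall>f::nat\<Rightarrow>nat. (\<forall>x. f x < r) \<longrightarrow>
     (\<exists>a d. 0 < d \<and> a \<le> W \<and> d \<le> W \<and> (\<forall>i\<in>{1..k}. f (a + i * d) = f (a + d)))"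
proof (induction k arbitrary: r)
  case 0
  show ?case by (rule exI[of _ 1]) (auto intro!: exI[of _ 1])
next
  case (Suc k)
  obtain M where M: "\<forall>f::nat\<Rightarrow>nat. (\<forall>x. f x < r) \<longrightarrow>
      (\<exists>z d. 0 < d \<and> z \<le> M \<and> d \<le> M \<and> (\<forall>i\<le>k. f (z + i * d) = f z)) \<or>
      (\<exists>z C. z \<le> M \<and> C \<subseteq> {..<r} \<and> card C = r \<and>
        (\<forall>c\<in>C. \<exists>d. 0 < d \<and> d \<le> M \<and> (\<forall>i\<in>{1..k}. f (z + i * d) = c)))"
    using focused_progressions[OF Suc.IH, of r r] by (rule exE)
  show ?case
  proof (rule exI[of _ "2 * M"], intro allI impI)
    fix f :: "nat \<Rightarrow> nat" assume f: "\<forall>x. f x < r"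
    \<comment> \<open>Shifting by \<open>M\<close> leaves room for the base point \<open>z - d\<close> of the progression.\<close>
    define g where "g x = f (x + M)" for x
    have g: "\<forall>x. g x < r" using f by (simp add: g_def)
    have "\<exists>z d. 0 < d \<and> z \<le> M \<and> d \<le> M \<and> (\<forall>i\<le>k. g (z + i * d) = g z)"
      using M[THEN spec, THEN mp, OF g]
    proof (elim disjE exE conjE)
      fix z C assume z: "z \<le> M" and C: "C \<subseteq> {..<r}" "card C = r"
        and fan: "\<forall>c\<in>C. \<exists>d. 0 < d \<and> d \<le> M \<and> (\<forall>i\<in>{1..k}. g (z + i * d) = c)"
      have "C = {..<r}" using C card_subset_eq[of "{..<r}" C] by simp
      then have "g z \<in> C" using g by simp
      then obtain d where d: "0 < d" "d \<le> M" "\<forall>i\<in>{1..k}. g (z + i * d) = g z"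
        using fan by blast
      have "g (z + i * d) = g z" if "i \<le> k" for i
        using d(3) that by (cases "i = 0") auto
      then show ?thesis using d z by blast
    qed blast
    then obtain z d where zd: "0 < d" "z \<le> M" "d \<le> M"
      and mono: "\<And>i. i \<le> k \<Longrightarrow> g (z + i * d) = g z" by blast
    have "f (z + M - d + i * d) = g z" if "i \<in> {1..Suc k}" for i
    proof -
      obtain j where j: "i = Suc j" "j \<le> k" using \<open>i \<in> {1..Suc k}\<close> by (cases i) auto
      have "z + M - d + i * d = z + j * d + M" using j(1) zd by simp
      then show ?thesis using mono[OF j(2)] by (simp add: g_def)
    qed
    moreover from this[of 1] have "f (z + M - d + d) = g z" by simp
    ultimately show "\<exists>a d. 0 < d \<and> a \<le> 2 * M \<and> d \<le> 2 * M \<and>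
        (\<forall>i\<in>{1..Suc k}. f (a + i * d) = f (a + d))"
      using zd by (intro exI[of _ "z + M - d"] exI[of _ d]) auto
  qed
qed

section \<open>Power residue characters\<close>

text \<open>
  The locale describes a nontrivial homomorphism from the units modulo \<open>p\<close> to the additive group
  modulo \<open>q\<close>, written with natural numbers below \<open>q\<close> as values, so that they can serve as colours.
  Multiples of \<open>p\<close> get an arbitrary value below \<open>q\<close>, which makes \<open>\<chi>\<close> a colouring of all integers.
\<close>

locale residue_character =
  fixes p q :: nat and \<chi> :: "int \<Rightarrow> nat"
  assumes prime_p: "prime p"
    and bounded: "\<chi> x < q"
    and mult: "\<not> int p dvd x \<Longrightarrow> \<not> int p dvd y \<Longrightarrow> \<chi> (x * y) = (\<chi> x + \<chi> y) mod q"
    and periodic: "[x = y] (mod int p) \<Longrightarrow> \<chi> x = \<chi> y"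
    and nontrivial: "\<exists>x. \<not> int p dvd x \<and> \<chi> x \<noteq> 0"
begin

lemma prime_int_p: "prime (int p)"
  using prime_p by simp

lemma not_dvd_of_nat_less: "0 < m \<Longrightarrow> m < p \<Longrightarrow> \<not> int p dvd int m"
  by (auto dest: dvd_imp_le)

lemma power_of:
  assumes "\<not> int p dvd x"
  shows "\<chi> (x ^ n) = (n * \<chi> x) mod q"
proof (induction n)
  case 0
  have "\<not> int p dvd 1" using prime_int_p not_prime_unit by blast
  from mult[OF this this] have "[0 + \<chi> 1 = \<chi> 1 + \<chi> 1] (mod q)"
    using bounded[of 1] by (simp add: cong_def)
  then have "[0 = \<chi> 1] (mod q)" by (simp only: cong_add_rcancel_nat)
  then show ?case using bounded[of 1] by (simp add: cong_def)
next
  case (Suc n)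
  have "\<not> int p dvd x ^ n" using assms prime_int_p prime_dvd_power by blast
  then show ?case using mult[OF assms, of "x ^ n"] Suc by (simp add: mod_add_right_eq)
qed

text \<open>
  A progression with difference \<open>h\<close> is, modulo \<open>p\<close>, an interval multiplied by \<open>h\<close>, and this
  multiplication shifts all classes by \<open>\<chi> h\<close>.
\<close>

lemma hits_scaled_class:
  assumes hits: "\<And>u. \<exists>i<B. int p dvd u + int i \<or> \<chi> (u + int i) = e"
    and h: "\<not> int p dvd h"
  shows "\<exists>i<B. int p dvd a + int i * h \<or> \<chi> (a + int i * h) = (e + \<chi> h) mod q"
proof -
  have "coprime h (int p)"
    using h prime_int_p prime_imp_coprime coprime_commute by blast
  then obtain h' where h': "[h * h' = 1] (mod int p)"
    using cong_solve_coprime_int by blast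
  obtain i where i: "i < B" "int p dvd a * h' + int i \<or> \<chi> (a * h' + int i) = e"
    using hits by blast
  have "[h * h' * a + h * int i = 1 * a + h * int i] (mod int p)"
    using h' by (intro cong_add cong_mult) auto
  then have c: "[h * (a * h' + int i) = a + int i * h] (mod int p)"
    by (simp add: algebra_simps)
  have "int p dvd a + int i * h" if "int p dvd a * h' + int i"
    using cong_dvd_iff[OF c] that by auto
  moreover have "\<chi> (a + int i * h) = (e + \<chi> h) mod q"
    if "\<not> int p dvd a * h' + int i" "\<chi> (a * h' + int i) = e"
    using periodic[OF c] mult[OF h that(1)] that(2) by (simp add: add.commute)
  ultimately show ?thesis using i by blast
qed

text \<open>
  A monochromatic progression with difference \<open>d\<close> must have the colour prescribed by
  \<open>hits_scaled_class\<close>. Taking every \<open>j\<close>-th term, the same colour is prescribed for the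
  difference \<open>j * d\<close>, so \<open>j\<close> cannot change the class. The bound on \<open>p\<close> keeps all terms of the
  progression between \<open>1\<close> and \<open>p - 1\<close>.
\<close>

lemma small_numbers_trivial:
  assumes hits: "\<And>u. \<exists>i<B. int p dvd u + int i \<or> \<chi> (u + int i) = e"
    and vdW: "\<forall>f::nat\<Rightarrow>nat. (\<forall>x. f x < q) \<longrightarrow>
      (\<exists>a d. 0 < d \<and> a \<le> W \<and> d \<le> W \<and> (\<forall>i\<in>{1..L * B + 1}. f (a + i * d) = f (a + d)))"
    and large: "p > W + (L * B + 1) * W + L"
    and j: "0 < j" "j \<le> L"
  shows "\<chi> (int j) = 0"
proof -
  obtain a d where ad: "0 < d" "a \<le> W" "d \<le> W"
    and mono: "\<And>i. i \<in> {1..L * B + 1} \<Longrightarrow> \<chi> (int (a + i * d)) = \<chi> (int (a + d))"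
    using vdW[THEN spec, THEN mp, of "\<lambda>x. \<chi> (int x)"] bounded by blast
  have "W \<le> (L * B + 1) * W" by simp
  with large ad have "d < p" by linarith
  then have d: "\<not> int p dvd int d" using ad not_dvd_of_nat_less by blast
  have jp: "\<not> int p dvd int j" using j large not_dvd_of_nat_less[of j] by linarith
  \<comment> \<open>The progression with difference \<open>d\<close> contains ones with difference \<open>t * d\<close>;
    applied to \<open>t = 1\<close> and \<open>t = j\<close>, this compares the classes of \<open>d\<close> and \<open>j * d\<close>.\<close>
  have forced: "\<chi> (int (a + d)) = (e + \<chi> (int t * int d)) mod q"
    if t: "0 < t" "t \<le> L" "\<not> int p dvd int t" for t
  proof -
    have "\<not> int p dvd int t * int d" using t d prime_int_p prime_dvd_mult_iff by blast
    from hits_scaled_class[OF hits this, of "int (a + d)"]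
    obtain i where i: "i < B" and
      *: "int p dvd int (a + d) + int i * (int t * int d) \<or>
        \<chi> (int (a + d) + int i * (int t * int d)) = (e + \<chi> (int t * int d)) mod q"
      by blast
    define l where "l = 1 + i * t"
    have eq: "int (a + d) + int i * (int t * int d) = int (a + l * d)"
      by (simp add: l_def algebra_simps)
    have "i * t \<le> B * L" using i t by (intro mult_le_mono) auto
    then have l: "l \<in> {1..L * B + 1}" by (simp add: l_def mult.commute)
    then have "l * d \<le> (L * B + 1) * W" using ad by (intro mult_le_mono) auto
    then have "a + l * d < p" using ad large by linarith
    moreover have "0 < a + l * d" using l ad by simp
    ultimately have "\<not> int p dvd int (a + l * d)" by (intro not_dvd_of_nat_less)
    then show ?thesis using * mono[OF l] unfolding eq by simp
  qed
  have one: "\<not> int p dvd int 1" using prime_int_p not_prime_unit by auto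
  have "(e + \<chi> (int d)) mod q = (e + \<chi> (int j * int d)) mod q"
    using forced[of 1] forced[of j] j jp one by simp
  then have "[e + \<chi> (int d) + 0 = e + \<chi> (int d) + \<chi> (int j)] (mod q)"
    using mult[OF jp d] by (simp add: cong_def mod_add_right_eq add_ac)
  then have "[0 = \<chi> (int j)] (mod q)" by (simp only: cong_add_lcancel_nat)
  then show ?thesis using bounded by (simp add: cong_def)
qed

text \<open>
  If small numbers have class \<open>0\<close>, the difference \<open>h\<close> in \<open>hits_scaled_class\<close> is taken to be the
  least positive \<open>N\<close> of nonzero class. A number below \<open>B * N\<close> with a prime factor \<open>t\<close> between
  \<open>B\<close> and \<open>N\<close> is a product of two factors below \<open>N\<close>, hence of class \<open>0\<close>. The Chinese remainder
  theorem provides a progression with difference \<open>N\<close> made of such numbers, using a different prime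
  for each term.
\<close>

lemma not_hits_trivial_class:
  fixes t :: "nat \<Rightarrow> nat"
  assumes t: "\<And>i. i < B \<Longrightarrow> prime (t i) \<and> B < t i" and inj: "inj_on t {..<B}"
    and small: "\<And>j. 0 < j \<Longrightarrow> j \<le> 2 * (\<Prod>i<B. t i) \<Longrightarrow> \<chi> (int j) = 0"
  shows "\<exists>u. \<forall>i<B. \<not> int p dvd u + int i \<and> \<chi> (u + int i) \<noteq> 0"
proof (rule ccontr)
  assume "\<not> ?thesis"
  then have hits: "\<exists>i<B. int p dvd u + int i \<or> \<chi> (u + int i) = 0" for u by blast
  define T where "T = (\<Prod>i<B. t i)"
  have "T > 0" unfolding T_def using t prime_gt_0_nat by (intro prod_pos) auto
  have tT: "t i \<le> T" if "i < B" for i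
    using dvd_prodI[of "{..<B}" i t] that \<open>T > 0\<close> by (auto simp: T_def dvd_imp_le)
  obtain x where x: "\<not> int p dvd x" "\<chi> x \<noteq> 0" using nontrivial by blast
  define y where "y = nat (x mod int p)"
  have pp: "p > 0" using prime_p prime_gt_0_nat by blast
  have y_eq: "int y = x mod int p" using pp by (simp add: y_def)
  have "y \<noteq> 0" using x(1) y_eq by (auto simp: dvd_eq_mod_eq_0)
  moreover have "y < p"
    using y_eq pos_mod_bound[of "int p" x] pp by linarith
  moreover have "\<chi> (int y) \<noteq> 0"
    using x(2) periodic[of "int y" x] y_eq by (simp add: cong_def)
  ultimately have ex: "\<exists>m. 0 < m \<and> m < p \<and> \<chi> (int m) \<noteq> 0" by blast
  define N where "N = (LEAST m. 0 < m \<and> m < p \<and> \<chi> (int m) \<noteq> 0)"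
  have N: "0 < N" "N < p" "\<chi> (int N) \<noteq> 0"
    using LeastI_ex[OF ex] by (simp_all add: N_def)
  have below: "\<chi> (int m) = 0" if "0 < m" "m < N" for m
    using not_less_Least[of m "\<lambda>m. 0 < m \<and> m < p \<and> \<chi> (int m) \<noteq> 0"] that N(2)
    by (auto simp: N_def)
  have "2 * T < N" using small[of N] N by (force simp: T_def not_le)
  \<comment> \<open>The residue \<open>i * N * (t i - 1)\<close> stands for \<open>- i * N\<close> modulo \<open>t i\<close>.\<close>
  have cop: "\<forall>i\<in>{..<B}. \<forall>j\<in>{..<B}. i \<noteq> j \<longrightarrow> coprime (t i) (t j)"
    using t inj by (auto intro!: primes_coprime dest: inj_onD)
  obtain a0 where a0: "\<And>i. i < B \<Longrightarrow> [a0 = i * N * (t i - 1)] (mod t i)"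
    using chinese_remainder_nat[OF _ cop, of "\<lambda>i. i * N * (t i - 1)"] by auto
  \<comment> \<open>Adding \<open>T\<close> makes \<open>a\<close> positive, so that no term of the progression vanishes.\<close>
  define a where "a = a0 mod T + T"
  have a: "T \<le> a" "a < N"
    using \<open>2 * T < N\<close> mod_less_divisor[OF \<open>T > 0\<close>, of a0] unfolding a_def by linarith+
  have dvd: "t i dvd a + i * N" if i: "i < B" for i
  proof -
    have "t i dvd T" unfolding T_def using i by (intro dvd_prodI) auto
    then have "[a = a0] (mod t i)"
      by (auto simp: a_def cong_def mod_mod_cancel mod_add_eq[symmetric, of _ T])
    then have "[a + i * N = i * N * (t i - 1) + i * N] (mod t i)"
      using a0[OF i] cong_trans cong_add_rcancel_nat by blast
    also have "i * N * (t i - 1) + i * N = i * N * t i"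
      using t[OF i] by (cases "t i") (auto simp: algebra_simps)
    finally show ?thesis by (simp add: cong_def dvd_eq_mod_eq_0)
  qed
  \<comment> \<open>Every term splits into two factors below the least nonresidue \<open>N\<close>.\<close>
  have residue: "\<not> int p dvd int (a + i * N) \<and> \<chi> (int (a + i * N)) = 0" if i: "i < B" for i
  proof -
    obtain m where m: "a + i * N = t i * m" using dvd[OF i] by blast
    have "0 < m" using m a \<open>T > 0\<close> by (cases m) auto
    have "a + i * N < N + i * N" using a by simp
    also have "\<dots> \<le> B * N" using i mult_le_mono1[of "Suc i" B N] by simp
    also have "\<dots> \<le> t i * N" using t[OF i] by simp
    finally have "m < N" using m by simp
    have "0 < t i" "t i < N" using t[OF i] tT[OF i] \<open>2 * T < N\<close> by auto
    then have 1: "\<not> int p dvd int (t i)" "\<not> int p dvd int m"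
      using \<open>0 < m\<close> \<open>m < N\<close> N(2) not_dvd_of_nat_less by auto
    have "\<chi> (int (t i) * int m) = 0"
      using mult[OF 1] below[OF \<open>0 < m\<close> \<open>m < N\<close>] below[OF \<open>0 < t i\<close> \<open>t i < N\<close>] by simp
    moreover have "\<not> int p dvd int (t i) * int m"
      using 1 prime_int_p prime_dvd_mult_iff by blast
    ultimately show ?thesis using m by simp
  qed
  have "\<not> int p dvd int N" using N not_dvd_of_nat_less by blast
  from hits_scaled_class[OF hits this, of "int a"] obtain i where "i < B"
    "int p dvd int a + int i * int N \<or> \<chi> (int a + int i * int N) = (0 + \<chi> (int N)) mod q"
    by blast
  then show False using residue[of i] N(3) bounded[of "int N"] by simp
qed

end

text \<open>
  The bound \<open>K\<close> depends only on \<open>q\<close> and \<open>B\<close>; this uniformity in \<open>\<chi>\<close> and \<open>e\<close> is what allows \<open>p\<close> to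
  be chosen first. Otherwise small numbers would have class \<open>0\<close>, so the gap is found
  near \<open>1\<close> if \<open>e \<noteq> 0\<close> and by \<open>not_hits_trivial_class\<close> if \<open>e = 0\<close>.
\<close>

theorem long_gap_in_class:
  "\<exists>K. \<forall>p \<chi> e. residue_character p q \<chi> \<longrightarrow> K < p \<longrightarrow>
     (\<exists>u. \<forall>i<B. \<not> int p dvd u + int i \<and> \<chi> (u + int i) \<noteq> e)"
proof -
  define S where "S = {t::nat. prime t \<and> B < t}"
  have S: "infinite S"
  proof -
    have "\<exists>t>m. t \<in> S" for m
      using bigger_prime[of "max m B"] by (auto simp: S_def)
    then show ?thesis by (simp add: infinite_nat_iff_unbounded)
  qed
  define t where "t = enumerate S"
  have t: "prime (t i) \<and> B < t i" for i
    using enumerate_in_set[OF S, of i] by (simp add: t_def S_def)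
  have inj: "inj_on t {..<B}"
    using inj_enumerate[OF S] by (auto simp: t_def intro: inj_on_subset)
  define L where "L = 2 * (\<Prod>i<B. t i) + B"
  obtain W where W: "\<forall>f::nat\<Rightarrow>nat. (\<forall>x. f x < q) \<longrightarrow>
      (\<exists>a d. 0 < d \<and> a \<le> W \<and> d \<le> W \<and> (\<forall>i\<in>{1..L * B + 1}. f (a + i * d) = f (a + d)))"
    using van_der_Waerden[of q "L * B + 1"] by (rule exE)
  show ?thesis
  proof (rule exI[of _ "W + (L * B + 1) * W + L"], intro allI impI)
    fix p \<chi> e
    assume "residue_character p q \<chi>" and large: "W + (L * B + 1) * W + L < p"
    then interpret residue_character p q \<chi> by simp
    show "\<exists>u. \<forall>i<B. \<not> int p dvd u + int i \<and> \<chi> (u + int i) \<noteq> e"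
    proof (rule ccontr)
      assume no_gap: "\<not> ?thesis"
      then have hits: "\<exists>i<B. int p dvd u + int i \<or> \<chi> (u + int i) = e" for u by blast
      have small: "\<chi> (int j) = 0" if "0 < j" "j \<le> L" for j
        using small_numbers_trivial[OF hits W large that] .
      show False
      proof (cases "e = 0")
        case True
        have "\<exists>u. \<forall>i<B. \<not> int p dvd u + int i \<and> \<chi> (u + int i) \<noteq> 0"
          using t inj small by (intro not_hits_trivial_class[of B t]) (auto simp: L_def)
        then show False using no_gap True by blast
      next
        case False
        obtain i where i: "i < B" "int p dvd 1 + int i \<or> \<chi> (1 + int i) = e"
          using hits by blast
        have "i + 1 \<le> L" using i by (simp add: L_def)
        moreover from this large have "i + 1 < p" by linarith
        ultimately show False
          using i False small[of "i + 1"] not_dvd_of_nat_less[of "i + 1"] by (simp add: add.commute)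
      qed
    qed
  qed
qed

text \<open>
  The discrete logarithm to a primitive root is determined modulo \<open>p - 1\<close>, hence modulo its divisor
  \<open>q\<close>.
\<close>

lemma residue_character_exists:
  assumes p: "prime p" and q: "q dvd p - 1" "1 < q"
  shows "\<exists>\<chi>. residue_character p q \<chi>"
proof -
  have p1: "p > 1" using p prime_gt_1_nat by blast
  obtain g where g: "residue_primroot p g" using prime_primitive_root_exists[of p] p p1 by auto
  then have cop: "coprime p g" and ord: "ord p g = p - 1"
    using p by (auto simp: residue_primroot_def totient_prime)
  have log_ex: "\<exists>j. [int (g ^ j) = x] (mod int p)" if x: "\<not> int p dvd x" for x
  proof -
    define y where "y = nat (x mod int p)"
    have y: "int y = x mod int p" using p1 by (simp add: y_def)
    have "y \<noteq> 0" using x y by (auto simp: dvd_eq_mod_eq_0)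
    moreover have "y < p" using y pos_mod_bound[of "int p" x] p1 by linarith
    ultimately have "y \<in> totatives p" using p by (simp add: totatives_prime)
    then have "y \<in> (\<lambda>j. g ^ j mod p) ` {..<totient p}"
      using bij_betw_imp_surj_on[OF residue_primroot_is_generator[OF p1 g]] by blast
    then obtain j where "g ^ j mod p = y" by blast
    then have "int (g ^ j) mod int p = x mod int p" using y zmod_int by metis
    then show ?thesis unfolding cong_def by blast
  qed
  have log_unique: "j mod q = l mod q" if "[int (g ^ j) = int (g ^ l)] (mod int p)" for j l
  proof -
    have "[g ^ j = g ^ l] (mod p)" using that cong_int_iff by blast
    then have "[j = l] (mod p - 1)" using order_divides_expdiff[OF cop] ord by simp
    then have "[j = l] (mod q)" using q(1) cong_dvd_modulus_nat by blast
    then show ?thesis by (simp add: cong_def)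
  qed
  define \<chi> where "\<chi> x = (SOME j. [int (g ^ j) = x] (mod int p)) mod q" for x
  have \<chi>: "\<chi> x = j mod q" if "[int (g ^ j) = x] (mod int p)" for x j
  proof -
    have "[int (g ^ (SOME j. [int (g ^ j) = x] (mod int p))) = x] (mod int p)"
      by (rule someI[of "\<lambda>j. [int (g ^ j) = x] (mod int p)", OF that])
    then show ?thesis unfolding \<chi>_def using that log_unique cong_trans cong_sym by meson
  qed
  have "residue_character p q \<chi>"
  proof
    show "\<chi> x < q" for x using q by (simp add: \<chi>_def)
    show "\<chi> (x * y) = (\<chi> x + \<chi> y) mod q" if xy: "\<not> int p dvd x" "\<not> int p dvd y" for x y
    proof -
      obtain j l where jl: "[int (g ^ j) = x] (mod int p)" "[int (g ^ l) = y] (mod int p)"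
        using log_ex[OF xy(1)] log_ex[OF xy(2)] by blast
      then have "[int (g ^ (j + l)) = x * y] (mod int p)"
        using cong_mult[OF jl] by (simp add: power_add)
      from \<chi>[OF this] \<chi>[OF jl(1)] \<chi>[OF jl(2)] show ?thesis by (simp add: mod_add_eq)
    qed
    show "\<chi> x = \<chi> y" if "[x = y] (mod int p)" for x y
    proof -
      have "[z = x] (mod int p) \<longleftrightarrow> [z = y] (mod int p)" for z
        using that cong_trans cong_sym by blast
      then show ?thesis by (simp add: \<chi>_def)
    qed
    have "[int (g ^ 1) = int g] (mod int p)" by simp
    from \<chi>[OF this] have "\<chi> (int g) = 1" using q by simp
    moreover have "\<not> int p dvd int g"
      using cop p1 by (auto simp: coprime_absorb_left)
    ultimately show "\<exists>x. \<not> int p dvd x \<and> \<chi> x \<noteq> 0" by (intro exI[of _ "int g"]) simp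
  qed (use p in auto)
  then show ?thesis by blast
qed

text \<open>
  A prime divisor \<open>p\<close> of the cyclotomic value \<open>1 + x + \<dots> + x\<^bsup>q - 1\<^esup>\<close> divides \<open>x\<^sup>q - 1\<close>, so \<open>x\<close> has
  order \<open>1\<close> or \<open>q\<close> modulo \<open>p\<close>; order \<open>1\<close> would make the value congruent to \<open>q\<close> and force
  \<open>p = q\<close>. The choice \<open>x = q * fact K\<close> excludes \<open>q\<close> and all primes up to \<open>K\<close>, because the value is
  congruent to \<open>1\<close> modulo \<open>x\<close>.
\<close>

lemma prime_one_mod_prime_exists:
  fixes q K :: nat
  assumes q: "prime q"
  shows "\<exists>p>K. prime p \<and> q dvd p - 1"
proof -
  define x where "x = q * fact K"
  define M where "M = (\<Sum>i<q. x ^ i)"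
  have q1: "q > 1" using q prime_gt_1_nat by blast
  have M_eq: "M = 1 + x * (\<Sum>i<q - 1. x ^ i)"
  proof -
    have "M = (\<Sum>i<Suc (q - 1). x ^ i)" using q1 by (simp add: M_def)
    also have "\<dots> = 1 + (\<Sum>i<q - 1. x ^ Suc i)" by (subst sum.lessThan_Suc_shift) simp
    finally show ?thesis by (simp add: sum_distrib_left)
  qed
  have "x > 0" using q1 by (simp add: x_def)
  moreover have "(\<Sum>i<q - 1. x ^ i) > 0" using q1 \<open>x > 0\<close> by (intro sum_pos) (auto simp: lessThan_empty_iff)
  ultimately have "x * (\<Sum>i<q - 1. x ^ i) > 0" by (rule mult_pos_pos)
  then have "M \<noteq> 1" unfolding M_eq by linarith
  then obtain p where p: "prime p" "p dvd M" using prime_factor_nat by blast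
  have px: "\<not> p dvd x"
  proof
    assume "p dvd x"
    then have "p dvd 1" using p(2) M_eq by (metis dvd_add_left_iff dvd_mult2)
    then show False using p(1) not_prime_unit by blast
  qed
  have "p > K"
  proof (rule ccontr)
    assume "\<not> p > K"
    then have "p dvd fact K" using p(1) prime_dvd_fact_iff by auto
    then show False using px by (simp add: x_def)
  qed
  have "int p dvd int M" using p(2) by simp
  also have "int M dvd int x ^ q - 1"
    by (subst power_diff_1_eq) (simp add: M_def)
  finally have "[int (x ^ q) = int 1] (mod int p)" by (simp add: cong_iff_dvd_diff)
  then have "[x ^ q = 1] (mod p)" using cong_int_iff by blast
  then have "ord p x dvd q" by (simp only: ord_divides)
  then have "ord p x = 1 \<or> ord p x = q" using q prime_nat_iff by blast
  moreover have "ord p x \<noteq> 1"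
  proof
    assume "ord p x = 1"
    then have "[x = 1] (mod p)" using ord_divides[of x 1 p] by simp
    then have "[M = (\<Sum>i<q. 1 ^ i)] (mod p)" unfolding M_def by (intro cong_sum cong_pow)
    then have "p dvd q" using p(2) cong_dvd_iff by fastforce
    then show False using px by (simp add: x_def)
  qed
  moreover have "coprime p x" using p(1) px prime_imp_coprime by blast
  ultimately have "q dvd p - 1"
    using order_divides_totient[of p x] p(1) by (simp add: totient_prime)
  then show ?thesis using p(1) \<open>p > K\<close> by blast
qed

section \<open>Completeness of binomials\<close>

text \<open>
  Since \<open>A * x ^ n\<close> is an integer, the real constant \<open>c\<close> enters only through \<open>\<lfloor>B * c\<rfloor>\<close>, and \<open>v\<close> is
  the quotient of an integer division by \<open>B\<close> with remainder \<open>s\<close>.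
\<close>

lemma floor_of_binomial:
  fixes A B x :: int and c :: real and n :: nat
  assumes B: "B > 0"
  defines "v \<equiv> \<lfloor>of_int A / of_int B * of_int x ^ n + c\<rfloor>"
  shows "\<exists>s<nat B. A * x ^ n = B * v - \<lfloor>of_int B * c\<rfloor> + int s"
proof -
  define y where "y = A * x ^ n"
  have v: "v = \<lfloor>of_int y / of_int B + c\<rfloor>" by (simp add: v_def y_def)
  have "of_int v \<le> of_int y / of_int B + c" "of_int y / of_int B + c < of_int v + 1"
    unfolding v by linarith+
  then have "of_int B * of_int v \<le> of_int B * (of_int y / of_int B + c)"
    "of_int B * (of_int y / of_int B + c) < of_int B * (of_int v + 1)"
    using B by (auto intro: mult_left_mono mult_strict_left_mono)
  moreover have "of_int B * (of_int y / of_int B + c) = of_int y + of_int B * c"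
    using B by (simp add: field_simps)
  ultimately have "of_int B * of_int v \<le> of_int y + of_int B * c"
    "of_int y + of_int B * c < of_int B * (of_int v + 1)"
    by (simp_all only:)
  then have "of_int (B * v - y) \<le> of_int B * c" "of_int B * c < of_int (B * v - y + B)"
    by (simp_all add: algebra_simps)
  then have "B * v - y \<le> \<lfloor>of_int B * c\<rfloor>" "\<lfloor>of_int B * c\<rfloor> < B * v - y + B"
    by (simp_all only: le_floor_iff floor_less_iff)
  then show ?thesis
    by (intro exI[of _ "nat (y + \<lfloor>of_int B * c\<rfloor> - B * v)"]) (auto simp: y_def nat_less_iff)
qed

text \<open>
  The missed residue is the solution \<open>v\<close> of \<open>B * v - \<lfloor>B * c\<rfloor> \<equiv> u\<close> modulo \<open>p\<close>: attaining it would make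
  some \<open>u + s\<close> in the gap congruent to \<open>A * x ^ n\<close>, which is divisible by \<open>p\<close> or has the class of
  \<open>A\<close>.
\<close>

lemma not_complete_of_gap:
  fixes A B :: int and c :: real
  assumes B: "B > 0" and P: "P = monom (of_int A / of_int B) n + [:c:]"
    and \<chi>: "residue_character p q \<chi>" and q: "q dvd n" "n > 0"
    and pB: "\<not> int p dvd B" and pA: "\<not> int p dvd A"
    and gap: "\<forall>i<nat B. \<not> int p dvd u + int i \<and> \<chi> (u + int i) \<noteq> \<chi> A"
  shows "\<not> complete_mod P (int p)"
proof
  interpret residue_character p q \<chi> by fact
  assume complete: "complete_mod P (int p)"
  define C where "C = \<lfloor>of_int B * c\<rfloor>"
  have "coprime B (int p)" using pB prime_int_p prime_imp_coprime coprime_commute by blast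
  then obtain B' where B': "[B * B' = 1] (mod int p)" using cong_solve_coprime_int by blast
  obtain x where x: "[\<lfloor>poly P (of_int x)\<rfloor> = B' * (u + C)] (mod int p)"
    using complete unfolding complete_mod_def by blast
  define v where "v = \<lfloor>poly P (of_int x)\<rfloor>"
  have "v = \<lfloor>of_int A / of_int B * of_int x ^ n + c\<rfloor>"
    by (simp add: v_def P poly_monom)
  then obtain s where s: "s < nat B" "A * x ^ n = B * v - C + int s"
    using floor_of_binomial[OF B, of A x n c] unfolding C_def by blast
  have "[B * v = B * (B' * (u + C))] (mod int p)" using x by (intro cong_mult) (auto simp: v_def)
  also have "B * (B' * (u + C)) = B * B' * (u + C)" by simp
  also have "[B * B' * (u + C) = 1 * (u + C)] (mod int p)" using B' by (intro cong_mult) auto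
  finally have "[B * v + (int s - C) = 1 * (u + C) + (int s - C)] (mod int p)"
    by (intro cong_add) auto
  moreover have "B * v + (int s - C) = A * x ^ n" "1 * (u + C) + (int s - C) = u + int s"
    using s(2) by simp_all
  ultimately have c: "[A * x ^ n = u + int s] (mod int p)" by (simp only:)
  have us: "\<not> int p dvd u + int s" "\<chi> (u + int s) \<noteq> \<chi> A" using gap s(1) by auto
  have "\<not> int p dvd A * x ^ n" using us(1) cong_dvd_iff[OF c] by simp
  then have xp: "\<not> int p dvd x ^ n" by auto
  then have "\<not> int p dvd x" using q(2) dvd_power dvd_trans by blast
  then have "\<chi> (x ^ n) = 0" using power_of[of x n] q(1) by (simp add: mod_eq_0_iff_dvd)
  then have "\<chi> (A * x ^ n) = \<chi> A" using mult[OF pA xp] bounded by simp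
  then show False using us(2) periodic[OF c] by simp
qed

lemma not_ud_mod_if_not_complete:
  assumes "\<not> complete_mod P m" and "m \<ge> 2"
  shows "\<not> ud_mod (\<lambda>k. \<lfloor>poly P (of_nat k)\<rfloor>) m"
proof
  assume ud: "ud_mod (\<lambda>k. \<lfloor>poly P (of_nat k)\<rfloor>) m"
  obtain r where r: "\<And>x::int. \<not> [\<lfloor>poly P (of_int x)\<rfloor> = r] (mod m)"
    using assms(1) by (auto simp: complete_mod_def)
  have none: "{k \<in> {1..N}. [\<lfloor>poly P (of_nat k)\<rfloor> = r] (mod m)} = {}" for N :: nat
  proof -
    have "\<not> [\<lfloor>poly P (of_nat k)\<rfloor> = r] (mod m)" for k :: nat using r[of "int k"] by simp
    then show ?thesis by blast
  qed
  have "(\<lambda>N. real (card {k \<in> {1..N}. [\<lfloor>poly P (of_nat k)\<rfloor> = r] (mod m)}) / real N)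
      \<longlonglongrightarrow> 1 / of_int m"
    using ud unfolding ud_mod_def by blast
  then have "(\<lambda>N::nat. 0::real) \<longlonglongrightarrow> 1 / of_int m" unfolding none by simp
  then have "0 = (1 / of_int m :: real)" by (rule LIMSEQ_unique[OF tendsto_const])
  then show False using assms(2) by simp
qed

text \<open>
  The case \<open>a = 0\<close> is separate because \<open>\<chi>\<close> says nothing about the class of \<open>A = 0\<close>; there
  \<open>P\<close> is constant and the next residue after \<open>\<lfloor>c\<rfloor>\<close> is missed.
\<close>

lemma arbitrarily_large_incomplete_prime:
  fixes a c :: real and n K :: nat
  assumes a: "a \<in> \<rat>" and n: "n > 1"
  shows "\<exists>p>K. prime p \<and> \<not> complete_mod (monom a n + [:c:]) (int p)"
proof -
  obtain A B where AB: "B > 0" "a = of_int A / of_int B"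
    using a by (elim Rats_cases') blast
  show ?thesis
  proof (cases "A = 0")
    case True
    obtain p where p: "p > K" "prime p" using bigger_prime by blast
    have "\<not> complete_mod (monom a n + [:c:]) (int p)"
    proof
      assume "complete_mod (monom a n + [:c:]) (int p)"
      then have "\<exists>x::int. [\<lfloor>c\<rfloor> = \<lfloor>c\<rfloor> + 1] (mod int p)"
        unfolding complete_mod_def using True AB by (simp add: poly_monom)
      then have "int p dvd 1" by (simp add: cong_iff_dvd_diff)
      then show False using p(2) by simp
    qed
    then show ?thesis using p by blast
  next
    case False
    obtain q where q: "prime q" "q dvd n" using n prime_factor_nat[of n] by auto
    obtain K0 where K0: "\<And>p \<chi> e. residue_character p q \<chi> \<Longrightarrow> K0 < p \<Longrightarrow>
       (\<exists>u. \<forall>i<nat B. \<not> int p dvd u + int i \<and> \<chi> (u + int i) \<noteq> e)"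
      using long_gap_in_class[of q "nat B"] by blast
    obtain p where p: "p > K + K0 + nat B + nat \<bar>A\<bar>" "prime p" "q dvd p - 1"
      using prime_one_mod_prime_exists[OF q(1)] by blast
    obtain \<chi> where \<chi>: "residue_character p q \<chi>"
      using residue_character_exists[OF p(2,3)] q(1) prime_gt_1_nat by blast
    obtain u where "\<forall>i<nat B. \<not> int p dvd u + int i \<and> \<chi> (u + int i) \<noteq> \<chi> A"
      using K0[OF \<chi>, of "\<chi> A"] p(1) by auto
    moreover have "\<not> int p dvd B" using p(1) AB(1) by (auto dest!: zdvd_imp_le)
    moreover have "\<not> int p dvd A" using p(1) False dvd_imp_le_int[of A "int p"] by auto
    ultimately have "\<not> complete_mod (monom a n + [:c:]) (int p)"
      using not_complete_of_gap[OF AB(1) _ \<chi> q(2)] AB(2) n by auto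
    then show ?thesis using p(1,2) by (intro exI[of _ p]) simp
  qed
qed

theorem theorem16:
  fixes a c :: real and n :: nat and P :: "real poly"
  assumes "a \<in> \<rat>" and "P = monom a n + [:c:]" and "n > 1"
  shows "infinite {p::int. prime p \<and> \<not> complete_mod P p} \<and>
    \<not> ud_in_Z (\<lambda>k. \<lfloor>poly P (of_nat k)\<rfloor>)"
proof
  have large: "\<exists>p>K. prime p \<and> \<not> complete_mod P (int p)" for K
    using arbitrarily_large_incomplete_prime[OF assms(1,3)] assms(2) by simp
  have "infinite {p::nat. prime p \<and> \<not> complete_mod P (int p)}"
    using large by (simp add: infinite_nat_iff_unbounded)
  then have "infinite (int ` {p::nat. prime p \<and> \<not> complete_mod P (int p)})"
    by (simp add: finite_image_iff)
  moreover have "int ` {p::nat. prime p \<and> \<not> complete_mod P (int p)} \<subseteq>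
      {p::int. prime p \<and> \<not> complete_mod P p}" by auto
  ultimately show "infinite {p::int. prime p \<and> \<not> complete_mod P p}"
    using finite_subset by blast
  obtain p where p: "prime p" "\<not> complete_mod P (int p)" using large by blast
  then have "int p \<ge> 2" using prime_ge_2_nat by force
  then show "\<not> ud_in_Z (\<lambda>k. \<lfloor>poly P (of_nat k)\<rfloor>)"
    using not_ud_mod_if_not_complete[OF p(2)] unfolding ud_in_Z_def by blast
qed

end
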